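(* Let $(\mathcal Q,d)$ be a separable and complete metric space and let $o\in\mathcal Q$ be an arbitrary fixed element. Let $Y$ be a random variable with values in $\mathcal Q$, and let $Y_1,Y_2,\dots$ be independent random variables with the same distribution as $Y$. Let $h\colon[0,\infty)\to[0,\infty)$ be a non-decreasing function and define $H\colon[0,\infty)\to[0,\infty)$, $H(x)=\int_0^x h(t)\,\mathrm dt$. Let $(\epsilon_n)_{n\in\mathbb N}\subseteq[0,\infty)$ with $\epsilon_n\to0$ as $n\to\infty$. Set $$M=\operatorname*{arg\,min}_{q\in\mathcal Q}\mathbb E[H(d(Y,q))-H(d(Y,o))],\qquad M_n=\epsilon_n\text{-}\operatorname*{arg\,min}_{q\in\mathcal Q}\frac1n\sum_{i=1}^n\bigl(H(d(Y_i,q))-H(d(Y_i,o))\bigr).$$ Assume: (1) almost surely the following is true: there is $N_0\in\mathbb N$ such that every closed and bounded subset (closed in $\mathcal Q$) of $\bigcup_{n\ge N_0}M_n$ is compact; (2) there is $b\in[1,\infty)$ such that $h(2x)\le b\,h(x)$ for all $x\ge0$; (3) $h(x)\to\infty$ as $x\to\infty$; (4) $\mathbb E[h(d(Y,o))]<\infty$. Then $$d_\subseteq(M_n,M)\to0\quad\text{almost surely as } n\to\infty.$$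
   Context: All random variables are defined on a common probability space $(\Omega,\Sigma,\mathbb P)$; $\mathcal Q$ carries its Borel $\sigma$-algebra. For $f\colon\mathcal Q\to\mathbb R$ and $\epsilon\ge0$: $\operatorname{arg\,min} f=\{q\in\mathcal Q: f(q)=\inf_{\mathcal Q} f\}$ and $\epsilon\text{-}\operatorname{arg\,min} f=\{q\in\mathcal Q: f(q)\le\epsilon+\inf_{\mathcal Q} f\}$ (empty if $\inf_{\mathcal Q} f=-\infty$). The one-sided Hausdorff distance between $B,B'\subseteq\mathcal Q$ is $d_\subseteq(B,B'):=\sup_{x\in B}\inf_{x'\in B'}d(x,x')\in[0,\infty]$, with $\sup\emptyset=0$ and $\inf\emptyset=\infty$. "Almost surely" means outside a set contained in a $\mathbb P$-null set. *)

theory Defs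
  imports "HOL-Probability.Probability"
begin

text \<open>The infima are taken in \<^typ>\<open>ereal\<close>, where an unbounded objective has infimum
  \<open>-\<infinity>\<close>; both sets below are then empty. In \<^typ>\<open>real\<close> the infimum of such an
  objective would be an unspecified number.\<close>

definition argmin :: "('a \<Rightarrow> real) \<Rightarrow> 'a set" where
  "argmin f = {q. ereal (f q) = (INF p. ereal (f p))}"

definition eps_argmin :: "real \<Rightarrow> ('a \<Rightarrow> real) \<Rightarrow> 'a set" where
  "eps_argmin \<epsilon> f = {q. ereal (f q) \<le> ereal \<epsilon> + (INF p. ereal (f p))}"

text \<open>In \<^typ>\<open>ennreal\<close> the supremum over the empty set is \<open>0\<close> and the infimum
  over the empty set is \<open>\<infinity>\<close>.\<close>

definition one_sided_hausdorff :: "'a::metric_space set \<Rightarrow> 'a set \<Rightarrow> ennreal" where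
  "one_sided_hausdorff B B' = (SUP x\<in>B. INF x'\<in>B'. ennreal (dist x x'))"

end

theory Submission
  imports Defs
begin

text \<open>Write \<open>loss q y = H (d y q) - H (d y o)\<close>, let \<open>F q\<close> be its expectation and \<open>F\<^sub>n q\<close> its
  empirical mean. Since \<open>H\<close> is the integral of the monotone \<open>h\<close>, differences of \<open>H\<close> are bounded by \<open>h\<close> at
  the larger argument, and doubling turns \<open>h (d y o + R)\<close> into at most \<open>b (h (d y o) + h R)\<close>. The loss is
  therefore Lipschitz in \<open>q\<close> on every ball about \<open>o\<close>, with a constant that is integrable in \<open>y\<close>
  (\<open>loss_lipschitz\<close>). This is why a first moment of \<open>h (d Y o)\<close> suffices, even though \<open>H (d Y o)\<close> itself
  may fail to be integrable.

  Outside one null set the strong law of large numbers holds for countably many functions: the losses at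
  a countable dense set of \<open>q\<close>, the function \<open>h (d y o)\<close>, and the indicator of one ball that carries more
  than a quarter of the mass. Three facts follow for each sample point outside that set.

  \<^item> On each ball the \<open>F\<^sub>n\<close> are eventually Lipschitz with one common constant, so that the convergence
    \<open>F\<^sub>n q \<longlongrightarrow> F q\<close> passes from the dense set to every \<open>q\<close> (\<open>tendsto_from_dense\<close>).

  \<^item> The approximate minimizers stay in one ball. With \<open>r = d q o\<close> large, each sample point near \<open>o\<close>
    contributes at least \<open>r h (r/4) / 2\<close> to the empirical sum and each other one at least \<open>- r h (d y o)\<close>;
    since \<open>h\<close> tends to infinity, \<open>F\<^sub>n q \<ge> 1\<close> (\<open>mean_loss_coercive\<close>), whereas \<open>F\<^sub>n o = 0\<close>.

  \<^item> If \<open>M\<^sub>n\<close> contained, for infinitely many \<open>n\<close>, a point at distance at least \<open>\<delta>\<close> from \<open>M\<close>, then the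
    compactness assumption would give a convergent subsequence of such points. By the equi-Lipschitz
    bound its limit minimizes \<open>F\<close>, a contradiction
    (\<open>eps_argmin_hausdorff_tendsto_zero\<close>).

  The strong law is proved for integrable functions on a sequence space by a maximal argument that needs
  first moments only (\<open>AE_bounded_run\<close>): a random walk with negative drift is almost
  surely bounded above, and applying this to \<open>f - c\<close> for every \<open>c\<close> slightly above the expectation, and
  to \<open>-f\<close>, gives convergence of the means.\<close>

section \<open>The strong law of large numbers\<close>

text \<open>The maximum of \<open>0\<close> and the first \<open>n\<close> partial sums of \<open>g (x i)\<close>. Recursion on the tail of the
  sequence, rather than on the last summand, is what makes the increments below computable from the
  independence of the first coordinate and the rest.\<close>

primrec running_max :: "('a \<Rightarrow> real) \<Rightarrow> nat \<Rightarrow> (nat \<Rightarrow> 'a) \<Rightarrow> real" where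
  "running_max g 0 x = 0"
| "running_max g (Suc n) x = max 0 (g (x 0) + running_max g n (\<lambda>i. x (Suc i)))"

lemma running_max_nonneg: "0 \<le> running_max g n x"
  by (cases n) auto

lemma running_max_mono: "m \<le> n \<Longrightarrow> running_max g m x \<le> running_max g n x"
proof (induction m arbitrary: n x)
  case 0
  then show ?case by (simp add: running_max_nonneg)
next
  case (Suc m)
  then obtain k where k: "n = Suc k" "m \<le> k" by (cases n) auto
  show ?case using Suc.IH[OF k(2), of "\<lambda>i. x (Suc i)"] by (auto simp: k(1))
qed

lemma sum_le_running_max: "(\<Sum>i<n. g (x i)) \<le> running_max g n x"
proof (induction n arbitrary: x)
  case (Suc n)
  have "(\<Sum>i<Suc n. g (x i)) = g (x 0) + (\<Sum>i<n. g (x (Suc i)))"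
    by (rule sum.lessThan_Suc_shift)
  also have "\<dots> \<le> g (x 0) + running_max g n (\<lambda>i. x (Suc i))"
    using Suc.IH[of "\<lambda>i. x (Suc i)"] by simp
  finally show ?case by simp
qed simp

definition unbounded_run :: "('a \<Rightarrow> real) \<Rightarrow> (nat \<Rightarrow> 'a) \<Rightarrow> bool" where
  "unbounded_run g x \<longleftrightarrow> (\<forall>k::nat. \<exists>n. real k < running_max g n x)"

text \<open>The first step shifts all later partial sums by a finite amount, so it does not affect
  unboundedness. This invariance replaces a zero-one law in the argument below.\<close>

lemma unbounded_run_case_nat [simp]: "unbounded_run g (case_nat s x) \<longleftrightarrow> unbounded_run g x"
proof -
  have step: "running_max g (Suc n) (case_nat s x) = max 0 (g s + running_max g n x)" for n
    by simp
  show ?thesis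
  proof
    assume L: "unbounded_run g (case_nat s x)"
    show "unbounded_run g x"
      unfolding unbounded_run_def
    proof
      fix k :: nat
      obtain k' :: nat where k': "real k + \<bar>g s\<bar> < real k'" using reals_Archimedean2 by blast
      from L obtain n where n: "real k' < running_max g n (case_nat s x)"
        unfolding unbounded_run_def by blast
      then obtain m where m: "n = Suc m" by (cases n) auto
      show "\<exists>n. real k < running_max g n x"
        using n k' unfolding m step by (intro exI[of _ m]) (auto simp: max_def split: if_splits)
    qed
  next
    assume R: "unbounded_run g x"
    show "unbounded_run g (case_nat s x)"
      unfolding unbounded_run_def
    proof
      fix k :: nat
      obtain k' :: nat where k': "real k + \<bar>g s\<bar> < real k'" using reals_Archimedean2 by blast
      from R obtain n where n: "real k' < running_max g n x"
        unfolding unbounded_run_def by blast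
      show "\<exists>n. real k < running_max g n (case_nat s x)"
        using n k' by (intro exI[of _ "Suc n"], unfold step) auto
    qed
  qed
qed

context sequence_space begin

lemma running_max_measurable [measurable]:
  assumes [measurable]: "g \<in> borel_measurable M"
  shows "running_max g n \<in> borel_measurable S"
proof (induction n)
  case 0
  have "running_max g 0 = (\<lambda>x. 0)" by auto
  then show ?case by simp
next
  case (Suc n)
  note [measurable] = Suc
  have "running_max g (Suc n) = (\<lambda>x. max 0 (g (x 0) + running_max g n (\<lambda>i. x (Suc i))))"
    by auto
  moreover have [measurable]: "(\<lambda>x i. x (Suc i)) \<in> measurable S S"
    by (rule measurable_PiM_single') (auto simp: space_PiM PiE_iff)
  then have "(\<lambda>x. max 0 (g (x 0) + running_max g n (\<lambda>i. x (Suc i)))) \<in> borel_measurable S"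
    by (intro borel_measurable_max borel_measurable_const borel_measurable_add
        measurable_compose[OF _ Suc]) measurable
  ultimately show ?case by simp
qed

lemma unbounded_run_measurable [measurable]:
  assumes [measurable]: "g \<in> borel_measurable M"
  shows "Measurable.pred S (unbounded_run g)"
proof -
  have "unbounded_run g = (\<lambda>x. \<forall>k::nat. \<exists>n. real k < running_max g n x)"
    by (auto simp: unbounded_run_def fun_eq_iff)
  moreover have "Measurable.pred S (\<lambda>x. \<forall>k::nat. \<exists>n. real k < running_max g n x)"
    by measurable
  ultimately show ?thesis by simp
qed

text \<open>A sequence of independent, identically distributed coordinates has the same law as one further
  independent coordinate put in front of it.\<close>

lemma integrable_shift:
  fixes F :: "(nat \<Rightarrow> 'a) \<Rightarrow> real"
  assumes "F \<in> borel_measurable S"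
  shows "integrable S F \<longleftrightarrow> integrable (M \<Otimes>\<^sub>M S) (\<lambda>(s, x). F (case_nat s x))"
    and "integral\<^sup>L S F = (\<integral>(s, x). F (case_nat s x) \<partial>(M \<Otimes>\<^sub>M S))"
proof -
  have [measurable]: "(\<lambda>(s, x). case_nat s x) \<in> measurable (M \<Otimes>\<^sub>M S) S" by measurable
  show "integrable S F \<longleftrightarrow> integrable (M \<Otimes>\<^sub>M S) (\<lambda>(s, x). F (case_nat s x))"
    by (subst PiM_iter[symmetric], subst integrable_distr_eq) (use assms in \<open>auto simp: case_prod_unfold\<close>)
  show "integral\<^sup>L S F = (\<integral>(s, x). F (case_nat s x) \<partial>(M \<Otimes>\<^sub>M S))"
    by (subst PiM_iter[symmetric], subst integral_distr) (use assms in \<open>auto simp: case_prod_unfold\<close>)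
qed

sublocale pair: pair_prob_space M S ..

lemma integrable_pair_fst:
  fixes f :: "'a \<Rightarrow> real"
  assumes "integrable M f" shows "integrable (M \<Otimes>\<^sub>M S) (\<lambda>p. f (fst p))"
  by (rule integrable_distr[of fst _ M]) (use assms in \<open>auto simp: P.distr_pair_fst\<close>)

lemma integrable_pair_snd:
  fixes F :: "(nat \<Rightarrow> 'a) \<Rightarrow> real"
  assumes "integrable S F" shows "integrable (M \<Otimes>\<^sub>M S) (\<lambda>p. F (snd p))"
proof -
  interpret swapped: pair_prob_space S M ..
  have "integrable (S \<Otimes>\<^sub>M M) (\<lambda>p. F (fst p))"
    by (rule integrable_distr[of fst _ S]) (use assms in \<open>auto simp: M.distr_pair_fst\<close>)
  from swapped.integrable_product_swap[OF this] show ?thesis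
    by (simp add: case_prod_unfold)
qed

lemma integrable_running_max:
  assumes g: "integrable M g"
  shows "integrable S (running_max g n)"
proof (induction n)
  case 0
  have "running_max g 0 = (\<lambda>x. 0)" by auto
  then show ?case by simp
next
  case (Suc n)
  have [measurable]: "g \<in> borel_measurable M" using g by simp
  have "integrable (M \<Otimes>\<^sub>M S) (\<lambda>(s, x). max 0 (g s + running_max g n x))"
    unfolding case_prod_unfold
    by (intro integrable_max Bochner_Integration.integrable_add integrable_zero
        integrable_pair_fst[OF g] integrable_pair_snd[OF Suc])
  then show ?case by (subst integrable_shift(1)) auto
qed

text \<open>Let \<open>T n\<close> be the running maximum and \<open>U\<close> the event that it is unbounded. By stationarity and
  invariance of \<open>U\<close>, the increment of \<open>E[T n; U]\<close> is \<open>E[max (- T n) (g s); U]\<close>, where the new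
  first coordinate \<open>s\<close> is independent of \<open>T n\<close> and \<open>U\<close>. This increment is
  nonnegative because \<open>T n\<close> is increasing in \<open>n\<close>. On \<open>U\<close> the integrand equals \<open>g s\<close> as soon as \<open>T n\<close> is large, so dominated
  convergence gives \<open>E[g] P(U) \<ge> 0\<close>, which for negative drift forces \<open>P(U) = 0\<close>.\<close>

lemma AE_bounded_run:
  assumes g: "integrable M g" and neg: "integral\<^sup>L M g < 0"
  shows "AE x in S. \<not> unbounded_run g x"
proof -
  have [measurable]: "g \<in> borel_measurable M" using g by simp
  let ?u = "\<lambda>x. of_bool (unbounded_run g x) :: real"
  have int_u: "integrable S (\<lambda>x. running_max g n x * ?u x)" for n
    by (rule Bochner_Integration.integrable_bound[OF integrable_running_max[OF g, of n]])
      (auto simp del: running_max.simps)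
  have increment: "(\<integral>p. max (- running_max g n (snd p)) (g (fst p)) * ?u (snd p) \<partial>(M \<Otimes>\<^sub>M S)) \<ge> 0" for n
  proof -
    have i1: "integrable (M \<Otimes>\<^sub>M S) (\<lambda>p. max 0 (g (fst p) + running_max g n (snd p)) * ?u (snd p))"
      using int_u[of "Suc n"] integrable_shift(1)[OF borel_measurable_integrable[OF int_u[of "Suc n"]]]
      by (simp add: case_prod_unfold)
    have i2: "integrable (M \<Otimes>\<^sub>M S) (\<lambda>p. running_max g n (snd p) * ?u (snd p))"
      by (rule integrable_pair_snd[OF int_u[of n]])
    have "0 \<le> integral\<^sup>L S (\<lambda>x. running_max g (Suc n) x * ?u x) - integral\<^sup>L S (\<lambda>x. running_max g n x * ?u x)"
      using running_max_mono[of n "Suc n" g]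
      by (simp del: running_max.simps, intro integral_mono int_u mult_right_mono) auto
    also have "integral\<^sup>L S (\<lambda>x. running_max g (Suc n) x * ?u x)
      = (\<integral>p. max 0 (g (fst p) + running_max g n (snd p)) * ?u (snd p) \<partial>(M \<Otimes>\<^sub>M S))"
      using integrable_shift(2)[OF borel_measurable_integrable[OF int_u[of "Suc n"]]]
      by (simp add: case_prod_unfold)
    also have "integral\<^sup>L S (\<lambda>x. running_max g n x * ?u x)
      = (\<integral>p. running_max g n (snd p) * ?u (snd p) \<partial>(M \<Otimes>\<^sub>M S))"
      using pair.integral_snd[of "\<lambda>s x. running_max g n x * ?u x"] i2
      by (simp add: case_prod_unfold M.prob_space)
    also have "(\<integral>p. max 0 (g (fst p) + running_max g n (snd p)) * ?u (snd p) \<partial>(M \<Otimes>\<^sub>M S)) - \<dots>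
      = (\<integral>p. max 0 (g (fst p) + running_max g n (snd p)) * ?u (snd p)
           - running_max g n (snd p) * ?u (snd p) \<partial>(M \<Otimes>\<^sub>M S))"
      using i1 i2 by simp
    also have "\<dots> = (\<integral>p. max (- running_max g n (snd p)) (g (fst p)) * ?u (snd p) \<partial>(M \<Otimes>\<^sub>M S))"
      by (rule Bochner_Integration.integral_cong) (auto simp: max_def algebra_simps)
    finally show ?thesis .
  qed
  have "(\<lambda>n. \<integral>p. max (- running_max g n (snd p)) (g (fst p)) * ?u (snd p) \<partial>(M \<Otimes>\<^sub>M S))
      \<longlonglongrightarrow> (\<integral>p. g (fst p) * ?u (snd p) \<partial>(M \<Otimes>\<^sub>M S))"
  proof (rule integral_dominated_convergence[where w = "\<lambda>p. \<bar>g (fst p)\<bar>"])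
    show "integrable (M \<Otimes>\<^sub>M S) (\<lambda>p. \<bar>g (fst p)\<bar>)"
      using integrable_pair_fst[OF g] by simp
    show "AE p in M \<Otimes>\<^sub>M S. (\<lambda>n. max (- running_max g n (snd p)) (g (fst p)) * ?u (snd p))
        \<longlonglongrightarrow> g (fst p) * ?u (snd p)"
    proof (rule AE_I2)
      fix p
      show "(\<lambda>n. max (- running_max g n (snd p)) (g (fst p)) * ?u (snd p)) \<longlonglongrightarrow> g (fst p) * ?u (snd p)"
      proof (cases "unbounded_run g (snd p)")
        case True
        obtain k :: nat where k: "- g (fst p) < real k" using reals_Archimedean2 by blast
        from True obtain m where m: "real k < running_max g m (snd p)"
          unfolding unbounded_run_def by blast
        have "\<forall>\<^sub>F n in sequentially. max (- running_max g n (snd p)) (g (fst p)) * ?u (snd p)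
            = g (fst p) * ?u (snd p)"
          using eventually_ge_at_top[of m]
        proof eventually_elim
          case (elim n)
          with running_max_mono[OF elim, of g "snd p"] m k show ?case by (simp add: max_def)
        qed
        then show ?thesis by (rule tendsto_eventually)
      qed simp
    qed
    \<comment> \<open>The running maximum is nonnegative, so cutting \<open>g\<close> off from below at \<open>- T n\<close> does not enlarge \<open>\<bar>g\<bar>\<close>.\<close>
    show "AE p in M \<Otimes>\<^sub>M S. norm (max (- running_max g n (snd p)) (g (fst p)) * ?u (snd p)) \<le> \<bar>g (fst p)\<bar>" for n
      using running_max_nonneg[of g n] by (intro AE_I2) (auto simp: max_def abs_if split: if_splits, smt+)
  qed measurable
  then have "0 \<le> (\<integral>p. g (fst p) * ?u (snd p) \<partial>(M \<Otimes>\<^sub>M S))"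
    by (rule LIMSEQ_le_const) (use increment in auto)
  also have "\<dots> = (\<integral>s. (\<integral>x. g s * ?u x \<partial>S) \<partial>M)"
  proof (subst pair.integral_fst)
    show "integrable (M \<Otimes>\<^sub>M S) (\<lambda>(s, x). g s * ?u x)"
      by (rule Bochner_Integration.integrable_bound[OF integrable_pair_fst[OF g]]) auto
  qed (simp add: case_prod_unfold)
  also have "\<dots> = integral\<^sup>L M g * integral\<^sup>L S ?u" by simp
  finally have "integral\<^sup>L S ?u \<le> 0"
    using neg by (simp add: zero_le_mult_iff)
  moreover have iu: "integrable S ?u"
    by (rule P.integrable_const_bound[of _ 1]) auto
  ultimately have "integral\<^sup>L S ?u = 0"
    by (intro antisym) auto
  then have "AE x in S. ?u x = 0"
    by (subst (asm) integral_nonneg_eq_0_iff_AE) (use iu in auto)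
  then show ?thesis by eventually_elim auto
qed

text \<open>With \<open>d\<close> strictly between the expectation and \<open>c\<close>, the walk with steps \<open>f - d\<close> has negative
  drift. Its partial sums are bounded by some \<open>k\<close>, and \<open>k\<close> is negligible against \<open>(c - d) n\<close>.\<close>

lemma AE_eventually_mean_less:
  assumes f: "integrable M f" and c: "integral\<^sup>L M f < c"
  shows "AE x in S. \<forall>\<^sub>F n in sequentially. (\<Sum>i<n. f (x i)) / real n < c"
proof -
  define d where "d = (integral\<^sup>L M f + c) / 2"
  have d: "integral\<^sup>L M f < d" "d < c" using c by (auto simp: d_def)
  have "AE x in S. \<not> unbounded_run (\<lambda>s. f s - d) x"
    by (rule AE_bounded_run) (use f d M.prob_space in auto)
  then show ?thesis
  proof eventually_elim
    case (elim x)
    then obtain k :: nat where k: "\<And>n. running_max (\<lambda>s. f s - d) n x \<le> real k"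
      unfolding unbounded_run_def by (auto simp: not_less)
    obtain m :: nat where m: "real k / (c - d) < real m" using reals_Archimedean2 by blast
    have "\<forall>\<^sub>F n in sequentially. n > m" by (rule eventually_gt_at_top)
    then show ?case
    proof eventually_elim
      case (elim n)
      have "(\<Sum>i<n. f (x i) - d) \<le> real k"
        using sum_le_running_max[of "\<lambda>s. f s - d" x n] k[of n] by simp
      then have "(\<Sum>i<n. f (x i)) \<le> real k + d * real n"
        by (simp add: sum_subtractf mult.commute)
      also have "real k < (c - d) * real n"
      proof -
        have "real k / (c - d) < real n" using m elim by linarith
        then show ?thesis using d by (simp add: field_simps)
      qed
      finally show ?case using elim by (simp add: field_simps)
    qed
  qed
qed

lemma strong_law_of_large_numbers:
  assumes f: "integrable M f"
  shows "AE x in S. (\<lambda>n. (\<Sum>i<n. f (x i)) / real n) \<longlonglongrightarrow> integral\<^sup>L M f"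
proof -
  let ?m = "integral\<^sup>L M f" and ?A = "\<lambda>f x n. (\<Sum>i<n. f (x i)) / real n"
  have upper: "AE x in S. \<forall>k::nat. \<forall>\<^sub>F n in sequentially. ?A f x n < ?m + 1 / real (Suc k)"
    unfolding AE_all_countable by (intro allI AE_eventually_mean_less[OF f]) auto
  have lower: "AE x in S. \<forall>k::nat. \<forall>\<^sub>F n in sequentially. ?A (\<lambda>s. - f s) x n < - ?m + 1 / real (Suc k)"
    unfolding AE_all_countable by (intro allI AE_eventually_mean_less) (use f in auto)
  from upper lower show ?thesis
  proof eventually_elim
    case (elim x)
    show ?case
    proof (rule tendstoI)
      fix e :: real assume "0 < e"
      then obtain k where k: "1 / real (Suc k) < e" using nat_approx_posE by blast
      from elim(1)[rule_format, of k] elim(2)[rule_format, of k]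
      show "\<forall>\<^sub>F n in sequentially. dist (?A f x n) ?m < e"
        by eventually_elim (use k in \<open>auto simp: sum_negf dist_real_def\<close>)
    qed
  qed
qed

end

text \<open>Independence says that the joint law of the \<open>X i\<close> is a product measure, so an almost sure statement
  on the sequence space carries over to any i.i.d. sample. The sample is numbered from \<open>1\<close>, the sequence
  space from \<open>0\<close>.\<close>

lemma (in prob_space) AE_iid_sequence:
  fixes X :: "nat \<Rightarrow> 'a \<Rightarrow> 'b"
  assumes indep: "indep_vars (\<lambda>_. N) X {1..}"
    and ident: "\<And>i. i \<ge> 1 \<Longrightarrow> distr M N (X i) = D"
    and AE: "AE x in \<Pi>\<^sub>M i\<in>UNIV. D. good x"
  shows "AE \<omega> in M. good (\<lambda>i. X (Suc i) \<omega>)"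
proof -
  have rv: "random_variable N (X i)" if "i \<in> {1..}" for i
    using indep that by (auto simp: indep_vars_def2)
  have D: "prob_space D" and sets_D: "sets D = sets N"
    using ident[of 1] rv[of 1] prob_space_distr[of "X 1" N] by (auto simp flip: ident)
  have joint: "distr M (\<Pi>\<^sub>M i\<in>{1..}. N) (\<lambda>\<omega>. \<lambda>i\<in>{1..}. X i \<omega>) = (\<Pi>\<^sub>M i\<in>{1..}. D)"
  proof -
    have "(\<Pi>\<^sub>M i\<in>{1..}. distr M N (X i)) = (\<Pi>\<^sub>M i\<in>{1..}. D)"
      by (rule PiM_cong) (use ident in auto)
    moreover have "{1::nat..} \<noteq> {}" by auto
    ultimately show ?thesis
      using indep_vars_iff_distr_eq_PiM'[of "{1..}" X "\<lambda>_. N"] rv indep by simp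
  qed
  have reindex: "distr (\<Pi>\<^sub>M i\<in>{1..}. D) (\<Pi>\<^sub>M i\<in>UNIV. D) (\<lambda>z. \<lambda>i\<in>UNIV. z (Suc i)) = (\<Pi>\<^sub>M i\<in>UNIV. D)"
    by (rule distr_PiM_reindex) (use D in auto)
  have "AE z in \<Pi>\<^sub>M i\<in>{1..}. D. good (\<lambda>i\<in>UNIV. z (Suc i))"
    by (rule AE_distrD[of _ _ "\<Pi>\<^sub>M i\<in>UNIV. D"]) (simp_all only: reindex AE, intro measurable_restrict measurable_component_singleton, auto)
  then have "AE \<omega> in M. good (\<lambda>i\<in>UNIV. (\<lambda>i\<in>{1..}. X i \<omega>) (Suc i))"
    unfolding joint[symmetric]
    by (rule AE_distrD[rotated]) (use rv in \<open>auto intro!: measurable_restrict\<close>)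
  then show ?thesis by (simp add: restrict_UNIV)
qed


section \<open>Cluster points of approximate minimizers\<close>

text \<open>Only closed subsets of the range itself are assumed compact, not the closure of the range. If the
  range has no limit point, it is already closed, hence compact; otherwise a limit point yields the
  subsequence.\<close>

lemma convergent_subseq_if_closed_subsets_compact:
  fixes X :: "nat \<Rightarrow> 'a::metric_space"
  assumes cpt: "\<And>A. A \<subseteq> range X \<Longrightarrow> closed A \<Longrightarrow> compact A"
  shows "\<exists>l r. strict_mono (r :: nat \<Rightarrow> nat) \<and> (X \<circ> r) \<longlonglongrightarrow> l"
proof (cases "\<exists>l. l islimpt range X")
  case True
  then obtain l where "l islimpt range X" ..
  from islimpt_range_imp_convergent_subsequence[OF this] show ?thesis by blast
next
  case False
  then have "closed (range X)" by (simp add: closed_limpt)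
  then have "compact (range X)" by (intro cpt) auto
  from this[unfolded compact_def, rule_format, of X] show ?thesis by blast
qed

lemma one_sided_hausdorff_tendsto_zeroI:
  assumes "\<And>e. e > 0 \<Longrightarrow> \<forall>\<^sub>F n in sequentially. \<forall>x\<in>B n. \<exists>x'\<in>B'. dist x x' < e"
  shows "(\<lambda>n. one_sided_hausdorff (B n) B') \<longlonglongrightarrow> 0"
proof (rule order_tendstoI)
  fix a :: ennreal assume "0 < a"
  then obtain e where e: "0 < e" "ennreal e < a"
    by (metis dense ennreal_cases ennreal_less_zero_iff less_top top.extremum_strict)
  show "\<forall>\<^sub>F n in sequentially. one_sided_hausdorff (B n) B' < a"
    using assms[OF e(1)]
  proof eventually_elim
    case (elim n)
    have "one_sided_hausdorff (B n) B' \<le> ennreal e"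
      unfolding one_sided_hausdorff_def
    proof (rule SUP_least)
      fix x assume "x \<in> B n"
      with elim obtain x' where "x' \<in> B'" "dist x x' < e" by blast
      then show "(INF x'\<in>B'. ennreal (dist x x')) \<le> ennreal e"
        by (intro INF_lower2[of x']) (auto intro: ennreal_leI)
    qed
    with e show ?case by simp
  qed
qed simp

lemma eps_argminD:
  assumes "q \<in> eps_argmin e f" shows "f q \<le> e + f p"
proof -
  have "ereal (f q) \<le> ereal e + (INF p. ereal (f p))" using assms by (simp add: eps_argmin_def)
  also have "\<dots> \<le> ereal e + ereal (f p)" by (intro add_left_mono INF_lower) simp
  finally show ?thesis by simp
qed

lemma argminI:
  assumes "\<And>p. f q \<le> f p" shows "q \<in> argmin f"
  unfolding argmin_def using assms by (auto intro!: antisym INF_greatest INF_lower)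

text \<open>The points of \<open>B n\<close> that stay \<open>\<delta>\<close> away from the minimizers of \<open>F\<close> would form a bounded sequence in
  the set covered by the compactness assumption, so some subsequence converges to a point \<open>l\<close>. The
  common Lipschitz constant allows evaluating \<open>Fn\<close> at \<open>l\<close> instead of at the moving points, and
  pointwise convergence then shows that \<open>l\<close> minimizes \<open>F\<close>. In particular the minimizers of \<open>F\<close> are
  nonempty whenever \<open>B n\<close> is nonempty infinitely often.\<close>

lemma eps_argmin_hausdorff_tendsto_zero:
  fixes F :: "'a::metric_space \<Rightarrow> real" and Fn :: "nat \<Rightarrow> 'a \<Rightarrow> real"
  assumes pointwise: "\<And>q. (\<lambda>n. Fn n q) \<longlonglongrightarrow> F q"
    and lipschitz: "\<And>R. \<exists>L. \<forall>\<^sub>F n in sequentially. \<forall>p\<in>cball c R. \<forall>q\<in>cball c R.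
        \<bar>Fn n p - Fn n q\<bar> \<le> L * dist p q"
    and bounded: "\<forall>\<^sub>F n in sequentially. B n \<subseteq> cball c R"
    and minimizers: "\<forall>\<^sub>F n in sequentially. B n \<subseteq> eps_argmin (e n) (Fn n)"
    and e: "e \<longlonglongrightarrow> 0"
    and compactness: "\<And>A. A \<subseteq> (\<Union>n\<in>{N..}. B n) \<Longrightarrow> closed A \<Longrightarrow> bounded A \<Longrightarrow> compact A"
  shows "(\<lambda>n. one_sided_hausdorff (B n) (argmin F)) \<longlonglongrightarrow> 0"
proof (rule one_sided_hausdorff_tendsto_zeroI, rule ccontr)
  fix \<delta> :: real assume "\<delta> > 0"
  define bad where "bad n x \<longleftrightarrow> x \<in> B n \<and> (\<forall>x'\<in>argmin F. \<delta> \<le> dist x x')" for n x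
  assume "\<not> (\<forall>\<^sub>F n in sequentially. \<forall>x\<in>B n. \<exists>x'\<in>argmin F. dist x x' < \<delta>)"
  then have "\<exists>\<^sub>F n in sequentially. \<exists>x. bad n x"
    unfolding not_eventually by (rule frequently_elim1) (auto simp: bad_def not_less)
  moreover from bounded minimizers eventually_ge_at_top[of N]
  have "\<forall>\<^sub>F n in sequentially. B n \<subseteq> cball c R \<and> B n \<subseteq> eps_argmin (e n) (Fn n) \<and> N \<le> n"
    by eventually_elim simp
  ultimately have "\<exists>\<^sub>F n in sequentially. (\<exists>x. bad n x) \<and>
      B n \<subseteq> cball c R \<and> B n \<subseteq> eps_argmin (e n) (Fn n) \<and> N \<le> n"
    by (rule frequently_eventually_frequently)
  moreover define K where "K = {n. (\<exists>x. bad n x) \<and>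
      B n \<subseteq> cball c R \<and> B n \<subseteq> eps_argmin (e n) (Fn n) \<and> N \<le> n}"
  ultimately have "infinite K"
    unfolding cofinite_eq_sequentially[symmetric] frequently_cofinite by simp
  from infinite_enumerate[OF this] obtain r :: "nat \<Rightarrow> nat"
    where r: "strict_mono r" and "\<forall>n. r n \<in> K" by blast
  then have r_in: "(\<exists>x. bad (r n) x) \<and> B (r n) \<subseteq> cball c R \<and>
      B (r n) \<subseteq> eps_argmin (e (r n)) (Fn (r n)) \<and> N \<le> r n" for n
    by (simp add: K_def)
  have "\<forall>n. \<exists>x. bad (r n) x" using r_in by simp
  then obtain X where X: "\<And>n. bad (r n) (X n)" using choice[of "\<lambda>n. bad (r n)"] by auto
  have X_ball: "X n \<in> cball c R" and X_min: "X n \<in> eps_argmin (e (r n)) (Fn (r n))" for n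
    using X[of n] r_in[of n] by (auto simp: bad_def)
  have "\<exists>l s. strict_mono (s :: nat \<Rightarrow> nat) \<and> (X \<circ> s) \<longlonglongrightarrow> l"
  proof (rule convergent_subseq_if_closed_subsets_compact, rule compactness)
    fix A assume A: "A \<subseteq> range X" "closed A"
    show "A \<subseteq> (\<Union>n\<in>{N..}. B n)"
    proof
      fix x assume "x \<in> A"
      then obtain n where "x = X n" using A(1) by blast
      then have "x \<in> B (r n)" "N \<le> r n" using X[of n] r_in[of n] by (simp_all add: bad_def)
      then show "x \<in> (\<Union>n\<in>{N..}. B n)" by auto
    qed
    show "closed A" by fact
    show "bounded A" by (rule bounded_subset[OF bounded_cball[of c R]]) (use A X_ball in blast)
  qed
  then obtain l s where s: "strict_mono (s :: nat \<Rightarrow> nat)" and lim: "(X \<circ> s) \<longlonglongrightarrow> l" by blast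
  define t where "t = r \<circ> s"
  have t: "filterlim t sequentially sequentially"
    unfolding t_def by (intro filterlim_subseq strict_mono_o r s)
  have l_ball: "l \<in> cball c R"
    by (rule closed_sequentially[OF closed_cball _ lim]) (use X_ball in auto)
  obtain L where L: "\<forall>\<^sub>F n in sequentially. \<forall>p\<in>cball c R. \<forall>q\<in>cball c R.
      \<bar>Fn n p - Fn n q\<bar> \<le> L * dist p q" using lipschitz by blast
  have "(\<lambda>n. L * dist (X (s n)) l) \<longlonglongrightarrow> L * dist l l"
    using lim by (intro tendsto_intros) (simp add: o_def)
  then have "(\<lambda>n. L * dist (X (s n)) l) \<longlonglongrightarrow> 0" by simp
  moreover have "\<forall>\<^sub>F n in sequentially. norm (Fn (t n) (X (s n)) - Fn (t n) l) \<le> L * dist (X (s n)) l"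
    using eventually_compose_filterlim[OF L t] by eventually_elim (use X_ball l_ball in auto)
  ultimately have diff: "(\<lambda>n. Fn (t n) (X (s n)) - Fn (t n) l) \<longlonglongrightarrow> 0"
    by (rule Lim_null_comparison[rotated])
  have "F l \<le> F p" for p
  proof -
    have "(\<lambda>n. e (t n) + Fn (t n) p - (Fn (t n) (X (s n)) - Fn (t n) l)) \<longlonglongrightarrow> 0 + F p - 0"
      by (intro tendsto_intros diff filterlim_compose[OF e t] filterlim_compose[OF pointwise t])
    moreover have "(\<lambda>n. Fn (t n) l) \<longlonglongrightarrow> F l"
      by (rule filterlim_compose[OF pointwise t])
    moreover have "Fn (t n) l \<le> e (t n) + Fn (t n) p - (Fn (t n) (X (s n)) - Fn (t n) l)" for n
      using eps_argminD[OF X_min[of "s n"], of p] by (simp add: t_def)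
    ultimately show ?thesis using LIMSEQ_le[of _ "F l" _ "0 + F p - 0"] by auto
  qed
  then have "l \<in> argmin F" by (rule argminI)
  then have "\<delta> \<le> dist ((X \<circ> s) n) l" for n using X[of "s n"] by (simp add: bad_def)
  moreover have "\<forall>\<^sub>F n in sequentially. dist ((X \<circ> s) n) l < \<delta>"
    using lim \<open>\<delta> > 0\<close> by (rule tendstoD)
  then obtain n where "dist ((X \<circ> s) n) l < \<delta>"
    using eventually_happens'[OF sequentially_bot] by blast
  ultimately show False by (meson not_less)
qed

text \<open>An \<open>\<epsilon>/2\<close> argument: moving from \<open>q\<close> to a nearby point of the dense set changes \<open>Fn\<close> and \<open>F\<close> by a
  small amount that is uniform in \<open>n\<close>.\<close>

lemma tendsto_from_dense:
  fixes Fn :: "nat \<Rightarrow> 'q::metric_space \<Rightarrow> real" and F :: "'q \<Rightarrow> real"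
  assumes dense: "\<And>q r. r > 0 \<Longrightarrow> \<exists>p\<in>D. dist p q < r"
    and conv: "\<And>p. p \<in> D \<Longrightarrow> (\<lambda>n. Fn n p) \<longlonglongrightarrow> F p"
    and Fn_lip: "\<And>R. \<exists>L. \<forall>\<^sub>F n in sequentially. \<forall>p\<in>cball c R. \<forall>q\<in>cball c R.
        \<bar>Fn n p - Fn n q\<bar> \<le> L * dist p q"
    and F_lip: "\<And>R. \<exists>L. \<forall>p\<in>cball c R. \<forall>q\<in>cball c R. \<bar>F p - F q\<bar> \<le> L * dist p q"
  shows "(\<lambda>n. Fn n q) \<longlonglongrightarrow> F q"
proof (rule tendstoI)
  fix e :: real assume "e > 0"
  define R where "R = dist c q + 1"
  obtain L where L: "\<forall>\<^sub>F n in sequentially. \<forall>p\<in>cball c R. \<forall>q\<in>cball c R.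
      \<bar>Fn n p - Fn n q\<bar> \<le> L * dist p q" using Fn_lip by blast
  obtain L' where L': "\<forall>p\<in>cball c R. \<forall>q\<in>cball c R. \<bar>F p - F q\<bar> \<le> L' * dist p q"
    using F_lip by blast
  define K where "K = \<bar>L\<bar> + \<bar>L'\<bar> + 1"
  have "K > 0" by (simp add: K_def)
  then obtain p where p: "p \<in> D" "dist p q < min 1 (e / (2 * K))"
    using dense[of "min 1 (e / (2 * K))" q] \<open>e > 0\<close> by auto
  have in_R: "p \<in> cball c R" "q \<in> cball c R"
    using p(2) dist_triangle[of c p q] by (auto simp: R_def dist_commute)
  have "K * dist p q \<le> e / 2"
    using p(2) \<open>K > 0\<close> by (auto simp: field_simps)
  moreover have "(L + L') * dist p q \<le> K * dist p q"
    by (intro mult_right_mono) (auto simp: K_def)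
  ultimately have small: "L * dist p q + L' * dist p q \<le> e / 2"
    by (simp only: distrib_right)
  have "\<forall>\<^sub>F n in sequentially. dist (Fn n p) (F p) < e / 2"
    using conv[OF p(1)] by (rule tendstoD) (use \<open>e > 0\<close> in simp)
  with L show "\<forall>\<^sub>F n in sequentially. dist (Fn n q) (F q) < e"
  proof eventually_elim
    case (elim n)
    with in_R L' have "\<bar>Fn n p - Fn n q\<bar> \<le> L * dist p q" "\<bar>F p - F q\<bar> \<le> L' * dist p q" by auto
    with elim(2) small show ?case unfolding dist_real_def by linarith
  qed
qed


section \<open>Integrals of monotone functions as losses\<close>

locale integrated_loss =
  fixes h H :: "real \<Rightarrow> real"
  assumes h_nonneg: "0 \<le> x \<Longrightarrow> 0 \<le> h x"
    and h_mono_on: "mono_on {0..} h"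
    and H_eq: "0 \<le> x \<Longrightarrow> H x = integral {0..x} h"
begin

lemma h_mono: "0 \<le> x \<Longrightarrow> x \<le> y \<Longrightarrow> h x \<le> h y"
  using h_mono_on by (auto simp: mono_on_def)

lemma H_increment_bounds:
  assumes "0 \<le> x" "x \<le> y"
  shows "h x * (y - x) \<le> H y - H x" and "H y - H x \<le> h y * (y - x)"
proof -
  have int: "h integrable_on {u..v}" if "0 \<le> u" for u v
    by (rule integrable_on_mono_on) (use that h_mono in \<open>auto simp: mono_on_def\<close>)
  have eq: "H y - H x = integral {x..y} h"
    using Henstock_Kurzweil_Integration.integral_combine[OF assms int[of 0]] assms by (simp add: H_eq)
  have "integral {x..y} (\<lambda>_. h x) \<le> integral {x..y} h"
    by (rule integral_le) (use int assms h_mono in auto)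
  then show "h x * (y - x) \<le> H y - H x" using eq assms by (simp add: mult.commute)
  have "integral {x..y} h \<le> integral {x..y} (\<lambda>_. h y)"
    by (rule integral_le) (use int assms h_mono in auto)
  then show "H y - H x \<le> h y * (y - x)" using eq assms by (simp add: mult.commute)
qed

lemma H_mono: "0 \<le> x \<Longrightarrow> x \<le> y \<Longrightarrow> H x \<le> H y"
  using H_increment_bounds(1)[of x y] h_nonneg[of x] by (smt (verit) mult_nonneg_nonneg)

lemma H_lipschitz:
  assumes "0 \<le> x" "x \<le> t" "0 \<le> y" "y \<le> t"
  shows "\<bar>H x - H y\<bar> \<le> h t * \<bar>x - y\<bar>"
proof -
  have *: "\<bar>H x - H y\<bar> \<le> h t * \<bar>x - y\<bar>" if "0 \<le> x" "x \<le> y" "y \<le> t" for x y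
  proof -
    have "\<bar>H x - H y\<bar> = H y - H x" using H_mono that by simp
    also have "\<dots> \<le> h y * (y - x)" using H_increment_bounds(2) that by simp
    also have "\<dots> \<le> h t * (y - x)" using h_mono[of y t] that by (intro mult_right_mono) auto
    finally show ?thesis using that by simp
  qed
  show ?thesis
    using *[of x y] *[of y x] assms by (cases "x \<le> y") (auto simp: abs_minus_commute)
qed

text \<open>Nothing is known about \<open>h\<close> and \<open>H\<close> on negative arguments, so monotonicity gives measurability only
  after composing with \<open>max 0\<close>, which leaves distances unchanged.\<close>

lemma h_dist_measurable: "(\<lambda>y. h (dist y c)) \<in> borel_measurable borel"
proof -
  have [measurable]: "(\<lambda>x. h (max 0 x)) \<in> borel_measurable borel"
    by (rule borel_measurable_mono) (auto simp: mono_def intro!: h_mono)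
  have [measurable]: "(\<lambda>y. dist y c) \<in> borel_measurable borel"
    by (intro borel_measurable_continuous_onI continuous_intros)
  have "(\<lambda>y. h (max 0 (dist y c))) \<in> borel_measurable borel" by measurable
  then show ?thesis by simp
qed

lemma H_dist_measurable: "(\<lambda>y. H (dist y c)) \<in> borel_measurable borel"
proof -
  have [measurable]: "(\<lambda>x. H (max 0 x)) \<in> borel_measurable borel"
    by (rule borel_measurable_mono) (auto simp: mono_def intro!: H_mono)
  have [measurable]: "(\<lambda>y. dist y c) \<in> borel_measurable borel"
    by (intro borel_measurable_continuous_onI continuous_intros)
  have "(\<lambda>y. H (max 0 (dist y c))) \<in> borel_measurable borel" by measurable
  then show ?thesis by simp
qed

definition loss :: "'q::metric_space \<Rightarrow> 'q \<Rightarrow> 'q \<Rightarrow> real" where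
  "loss c q y = H (dist y q) - H (dist y c)"

lemma loss_measurable [measurable]: "loss c q \<in> borel_measurable borel"
proof -
  have "loss c q = (\<lambda>y. H (dist y q) - H (dist y c))" by (auto simp: loss_def)
  with H_dist_measurable[of q] H_dist_measurable[of c] show ?thesis by simp
qed

text \<open>The loss is negative only if \<open>y\<close> is closer to \<open>q\<close> than to \<open>c\<close>; then its absolute value is the
  increment of \<open>H\<close> over an interval that ends at \<open>d y c\<close> and has length at most \<open>d q c\<close>.\<close>

lemma loss_ge:
  "- dist q c * h (dist y c) \<le> loss c q y"
proof (cases "dist y c \<le> dist y q")
  case True
  then have "0 \<le> loss c q y" using H_mono[of "dist y c" "dist y q"] by (simp add: loss_def)
  moreover have "0 \<le> dist q c * h (dist y c)" using h_nonneg[of "dist y c"] by simp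
  ultimately show ?thesis by linarith
next
  case False
  then have "H (dist y c) - H (dist y q) \<le> h (dist y c) * (dist y c - dist y q)"
    using H_increment_bounds(2)[of "dist y q" "dist y c"] by simp
  also have "\<dots> \<le> h (dist y c) * dist q c"
    using h_nonneg[of "dist y c"] dist_triangle[of y c q] by (intro mult_left_mono) auto
  finally show ?thesis by (simp add: loss_def algebra_simps)
qed

text \<open>For \<open>r = d q c \<ge> 4 K\<close>, the distance from \<open>y\<close> to \<open>c\<close> is at most \<open>r/4\<close> and the one to \<open>q\<close> at least
  \<open>3 r/4\<close>, so \<open>H\<close> gains at least \<open>h (r/4)\<close> times \<open>r/2\<close>.\<close>

lemma loss_ge_near_centre:
  assumes "dist y c \<le> K" "4 * K \<le> dist q c"
  shows "dist q c * (h (dist q c / 4) / 2) \<le> loss c q y"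
proof -
  define r where "r = dist q c"
  have r: "dist y c \<le> r / 4" "3 * r / 4 \<le> dist y q" "0 \<le> r"
    using assms dist_triangle[of q c y] by (auto simp: r_def dist_commute)
  have "r * (h (r / 4) / 2) = h (r / 4) * (3 * r / 4 - r / 4)" by (simp add: field_simps)
  also have "\<dots> \<le> H (3 * r / 4) - H (r / 4)"
    using r by (intro H_increment_bounds) auto
  also have "\<dots> \<le> H (dist y q) - H (dist y c)"
    using r by (intro diff_mono H_mono) auto
  finally show ?thesis by (simp add: loss_def r_def)
qed

lemma loss_coercive:
  assumes "4 * K \<le> dist q c"
  shows "dist q c * (h (dist q c / 4) / 2 * indicator (cball c K) y - h (dist y c)) \<le> loss c q y"
proof (cases "dist y c \<le> K")
  case True
  then have "dist q c * (h (dist q c / 4) / 2) \<le> loss c q y"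
    using assms by (rule loss_ge_near_centre)
  moreover have "0 \<le> dist q c * h (dist y c)" using h_nonneg[of "dist y c"] by simp
  ultimately show ?thesis using True by (simp add: algebra_simps dist_commute)
next
  case False
  then show ?thesis using loss_ge[of q c y] by (simp add: dist_commute)
qed

end

locale doubling_loss = integrated_loss +
  fixes b :: real
  assumes b: "1 \<le> b" and doubling: "0 \<le> x \<Longrightarrow> h (2 * x) \<le> b * h x"
begin

lemma h_add_le:
  assumes "0 \<le> x" "0 \<le> y"
  shows "h (x + y) \<le> b * (h x + h y)"
proof -
  have "h (x + y) \<le> h (2 * max x y)" using assms by (intro h_mono) auto
  also have "\<dots> \<le> b * h (max x y)" using assms by (intro doubling) auto
  also have "\<dots> \<le> b * (h x + h y)"
    using assms b h_nonneg[of x] h_nonneg[of y] by (intro mult_left_mono) (auto simp: max_def)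
  finally show ?thesis .
qed

text \<open>Doubling separates the contribution of \<open>y\<close> from the radius \<open>R\<close>, which leaves a Lipschitz constant
  that is integrable in \<open>y\<close> as soon as \<open>h (d y c)\<close> is.\<close>

lemma loss_lipschitz:
  assumes "p \<in> cball c R" "q \<in> cball c R"
  shows "\<bar>loss c p y - loss c q y\<bar> \<le> b * (h (dist y c) + h R) * dist p q"
proof -
  have R: "0 \<le> R" using assms(1) zero_le_dist[of c p] by (auto simp del: zero_le_dist)
  have le: "dist y z \<le> dist y c + R" if "z \<in> cball c R" for z
    using that dist_triangle[of y z c] by auto
  have "\<bar>loss c p y - loss c q y\<bar> = \<bar>H (dist y p) - H (dist y q)\<bar>" by (simp add: loss_def)
  also have "\<dots> \<le> h (dist y c + R) * \<bar>dist y p - dist y q\<bar>"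
    using le assms by (intro H_lipschitz) auto
  also have "\<dots> \<le> h (dist y c + R) * dist p q"
    using h_nonneg[of "dist y c + R"] R dist_triangle[of y p q] dist_triangle[of y q p]
    by (intro mult_left_mono) (auto simp: dist_commute)
  also have "\<dots> \<le> b * (h (dist y c) + h R) * dist p q"
    using R by (intro mult_right_mono h_add_le) auto
  finally show ?thesis .
qed

lemma abs_loss_le: "\<bar>loss c q y\<bar> \<le> b * (h (dist y c) + h (dist q c)) * dist q c"
  using loss_lipschitz[of q c "dist q c" c y] by (simp add: loss_def dist_commute)

end

section \<open>Consistency of empirical minimizers\<close>

definition mean :: "nat \<Rightarrow> ('q \<Rightarrow> real) \<Rightarrow> (nat \<Rightarrow> 'q) \<Rightarrow> real" where
  "mean n f x = (\<Sum>i<n. f (x i)) / real n"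

lemma mean_mono: "(\<And>y. f y \<le> g y) \<Longrightarrow> mean n f x \<le> mean n g x"
  unfolding mean_def by (intro divide_right_mono sum_mono) auto

lemma abs_mean_le: "\<bar>mean n f x\<bar> \<le> mean n (\<lambda>y. \<bar>f y\<bar>) x"
  by (simp add: mean_def divide_right_mono)

lemma mean_diff: "mean n (\<lambda>y. f y - g y) x = mean n f x - mean n g x"
  by (simp add: mean_def sum_subtractf diff_divide_distrib)

lemma mean_add: "mean n (\<lambda>y. f y + g y) x = mean n f x + mean n g x"
  by (simp add: mean_def sum.distrib add_divide_distrib)

lemma mean_cmult: "mean n (\<lambda>y. k * f y) x = k * mean n f x"
  by (simp add: mean_def sum_distrib_left)

lemma mean_const: "n > 0 \<Longrightarrow> mean n (\<lambda>y. k) x = k"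
  by (simp add: mean_def)


context doubling_loss begin

lemma mean_loss_lipschitz:
  assumes "n > 0" "mean n (\<lambda>y. h (dist y c)) x < m" "p \<in> cball c R" "q \<in> cball c R"
  shows "\<bar>mean n (loss c p) x - mean n (loss c q) x\<bar> \<le> b * (m + h R) * dist p q"
proof -
  have "\<bar>mean n (loss c p) x - mean n (loss c q) x\<bar> \<le> mean n (\<lambda>y. \<bar>loss c p y - loss c q y\<bar>) x"
    unfolding mean_diff[symmetric] by (rule abs_mean_le)
  also have "\<dots> \<le> mean n (\<lambda>y. b * dist p q * (h (dist y c) + h R)) x"
    using loss_lipschitz[OF assms(3,4)] by (intro mean_mono) (simp add: mult_ac)
  also have "\<dots> = b * dist p q * (mean n (\<lambda>y. h (dist y c)) x + h R)"
    using assms(1) by (simp add: mean_cmult mean_add mean_const)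
  also have "\<dots> \<le> b * dist p q * (m + h R)"
    using assms(2) b by (intro mult_left_mono) auto
  finally show ?thesis by (simp add: mult_ac)
qed

text \<open>The mean loss at distance \<open>r\<close> is at least \<open>r\<close> times the difference of \<open>h (r/4) / 2\<close> times the
  empirical mass of the ball and the empirical mean of \<open>h (d y c)\<close>. The second term stays below \<open>m\<close>,
  while the first one grows without bound in \<open>r\<close>.\<close>

lemma mean_loss_coercive:
  assumes h_lim: "filterlim h at_top at_top"
    and mass: "\<forall>\<^sub>F n in sequentially. 1 / 4 < mean n (indicator (cball c K)) x"
    and moment: "\<forall>\<^sub>F n in sequentially. mean n (\<lambda>y. h (dist y c)) x < m"
  shows "\<exists>R. \<forall>\<^sub>F n in sequentially. \<forall>q. R \<le> dist q c \<longrightarrow> 1 \<le> mean n (loss c q) x"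
proof -
  \<comment> \<open>With mass \<open>1/4\<close> and the factor \<open>1/2\<close>, the value \<open>8 (\<bar>m\<bar> + 1)\<close> of \<open>h\<close> becomes \<open>\<bar>m\<bar> + 1\<close>.\<close>
  from h_lim have "\<forall>\<^sub>F t in at_top. 8 * (\<bar>m\<bar> + 1) \<le> h t"
    by (simp add: filterlim_at_top)
  then obtain t\<^sub>0 where t\<^sub>0: "\<And>t. t\<^sub>0 \<le> t \<Longrightarrow> 8 * (\<bar>m\<bar> + 1) \<le> h t"
    by (auto simp: eventually_at_top_linorder)
  define R where "R = max 1 (max (4 * K) (4 * t\<^sub>0))"
  show ?thesis
  proof (rule exI[of _ R], use mass moment in eventually_elim, intro allI impI)
    fix n q
    assume n: "1 / 4 < mean n (indicator (cball c K)) x" "mean n (\<lambda>y. h (dist y c)) x < m"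
      and q: "R \<le> dist q c"
    define r where "r = dist q c"
    have r: "1 \<le> r" "4 * K \<le> r" "t\<^sub>0 \<le> r / 4" using q by (auto simp: r_def R_def)
    have "\<bar>m\<bar> + 1 \<le> h (r / 4) / 2 * (1 / 4)" using t\<^sub>0[OF r(3)] by simp
    also have "\<dots> \<le> h (r / 4) / 2 * mean n (indicator (cball c K)) x"
      using n(1) h_nonneg[of "r / 4"] r(1) by (intro mult_left_mono) auto
    finally have "1 \<le> h (r / 4) / 2 * mean n (indicator (cball c K)) x - mean n (\<lambda>y. h (dist y c)) x"
      using n(2) by linarith
    with r(1) have "1 \<le> r * (h (r / 4) / 2 * mean n (indicator (cball c K)) x - mean n (\<lambda>y. h (dist y c)) x)"
      using mult_mono[of 1 r 1] by fastforce
    also have "\<dots> = mean n (\<lambda>y. r * (h (r / 4) / 2 * indicator (cball c K) y - h (dist y c))) x"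
      by (simp only: mean_cmult mean_diff)
    also have "\<dots> \<le> mean n (loss c q) x"
      using loss_coercive[of K q c] r(2) by (intro mean_mono) (simp add: r_def)
    finally show "1 \<le> mean n (loss c q) x" .
  qed
qed

text \<open>The sets \<open>B n\<close> and the index \<open>N\<close> are quantified inside the almost sure statement, because the
  compactness condition depends on the sample and need not describe a measurable event. The
  family is determined only from \<open>n = 1\<close> on, since an empirical mean needs at least one observation.\<close>

lemma AE_eps_argmin_consistent:
  fixes D :: "'q::polish_space measure"
  assumes D: "prob_space D" and sets_D: "sets D = sets borel"
    and moment: "integrable D (\<lambda>y. h (dist y c))"
    and h_lim: "filterlim h at_top at_top"
    and e: "e \<longlonglongrightarrow> 0"
  shows "AE x in \<Pi>\<^sub>M i\<in>(UNIV::nat set). D. \<forall>B N.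
     (\<forall>n\<ge>1. B n = eps_argmin (e n) (\<lambda>q. mean n (loss c q) x)) \<longrightarrow>
     (\<forall>A. A \<subseteq> (\<Union>n\<in>{N..}. B n) \<longrightarrow> closed A \<longrightarrow> bounded A \<longrightarrow> compact A) \<longrightarrow>
     (\<lambda>n. one_sided_hausdorff (B n) (argmin (\<lambda>q. \<integral>y. loss c q y \<partial>D))) \<longlonglongrightarrow> 0"
proof -
  interpret D: prob_space D by fact
  interpret sequence_space D by unfold_locales
  have borel_D [measurable_cong]: "sets D = sets borel" by fact
  define F where "F q = (\<integral>y. loss c q y \<partial>D)" for q
  define m where "m = (\<integral>y. h (dist y c) \<partial>D)"
  have int_loss: "integrable D (loss c q)" for q
  proof (rule Bochner_Integration.integrable_bound)
    show "integrable D (\<lambda>y. b * (h (dist y c) + h (dist q c)) * dist q c)"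
      using moment by (intro integrable_mult_left integrable_mult_right
          Bochner_Integration.integrable_add D.integrable_const)
    show "loss c q \<in> borel_measurable D" by measurable
    show "AE y in D. norm (loss c q y) \<le> norm (b * (h (dist y c) + h (dist q c)) * dist q c)"
    proof (rule AE_I2)
      fix y show "norm (loss c q y) \<le> norm (b * (h (dist y c) + h (dist q c)) * dist q c)"
        using abs_loss_le[of c q y] by simp
    qed
  qed
  have F_lip: "\<exists>L. \<forall>p\<in>cball c R. \<forall>q\<in>cball c R. \<bar>F p - F q\<bar> \<le> L * dist p q" for R
  proof (intro exI ballI)
    fix p q assume pq: "p \<in> cball c R" "q \<in> cball c R"
    have "\<bar>F p - F q\<bar> = \<bar>\<integral>y. loss c p y - loss c q y \<partial>D\<bar>"
      using int_loss by (simp add: F_def)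
    also have "\<dots> \<le> (\<integral>y. \<bar>loss c p y - loss c q y\<bar> \<partial>D)"
      by (rule integral_abs_bound)
    also have "\<dots> \<le> (\<integral>y. b * (h (dist y c) + h R) * dist p q \<partial>D)"
      using int_loss moment loss_lipschitz[OF pq] by (intro integral_mono) auto
    also have "\<dots> = b * (m + h R) * dist p q"
      using moment by (simp add: m_def D.prob_space)
    finally show "\<bar>F p - F q\<bar> \<le> b * (m + h R) * dist p q" .
  qed
  \<comment> \<open>The balls about \<open>c\<close> exhaust the space, so some ball has mass above \<open>1/4\<close>.\<close>
  obtain K where K: "1 / 4 < D.prob (cball c K)"
  proof -
    have "(\<lambda>i. D.prob (cball c (real i))) \<longlonglongrightarrow> D.prob (\<Union>i. cball c (real i))"
      by (rule D.finite_Lim_measure_incseq) (auto simp: sets_D incseq_def)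
    moreover have "(\<Union>i. cball c (real i)) = space D"
      using sets_eq_imp_space_eq[OF sets_D] real_arch_simple by auto
    ultimately have "\<forall>\<^sub>F i in sequentially. 1 / 4 < D.prob (cball c (real i))"
      by (intro order_tendstoD(1)) (auto simp: D.prob_space)
    from eventually_happens'[OF sequentially_bot this] that show ?thesis by blast
  qed
  obtain Q :: "'q set" where "countable Q" and Q: "\<And>U. open U \<Longrightarrow> U \<noteq> {} \<Longrightarrow> \<exists>p\<in>Q. p \<in> U"
    by (rule countable_dense_setE) blast
  have dense: "\<exists>p\<in>Q. dist p q < r" if "r > 0" for q r
    using Q[of "ball q r"] that by (auto simp: dist_commute)
  have "AE x in S. \<forall>p\<in>Q. (\<lambda>n. mean n (loss c p) x) \<longlonglongrightarrow> F p"
    unfolding F_def mean_def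
    by (intro AE_ball_countable' strong_law_of_large_numbers int_loss \<open>countable Q\<close>)
  moreover have "AE x in S. (\<lambda>n. mean n (\<lambda>y. h (dist y c)) x) \<longlonglongrightarrow> m"
    unfolding m_def mean_def by (rule strong_law_of_large_numbers[OF moment])
  moreover have "AE x in S. (\<lambda>n. mean n (indicator (cball c K)) x) \<longlonglongrightarrow> (\<integral>y. indicator (cball c K) y \<partial>D)"
    unfolding mean_def by (rule strong_law_of_large_numbers)
      (auto simp: sets_D D.emeasure_eq_measure intro!: integrable_real_indicator)
  ultimately show ?thesis
    unfolding F_def[symmetric]
  proof eventually_elim
    case (elim x)
    show ?case
    proof (intro allI impI)
      fix B N
      assume B: "\<forall>n\<ge>1. B n = eps_argmin (e n) (\<lambda>q. mean n (loss c q) x)"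
        and compactness: "\<forall>A. A \<subseteq> (\<Union>n\<in>{N..}. B n) \<longrightarrow> closed A \<longrightarrow> bounded A \<longrightarrow> compact A"
      have moment': "\<forall>\<^sub>F n in sequentially. mean n (\<lambda>y. h (dist y c)) x < m + 1"
        using elim(2) by (rule order_tendstoD) simp
      have mass: "\<forall>\<^sub>F n in sequentially. 1 / 4 < mean n (indicator (cball c K)) x"
        using elim(3) by (rule order_tendstoD) (use K sets_D in simp)
      obtain R where R: "\<forall>\<^sub>F n in sequentially. \<forall>q. R \<le> dist q c \<longrightarrow> 1 \<le> mean n (loss c q) x"
        using mean_loss_coercive[OF h_lim mass moment'] by blast
      have lip: "\<exists>L. \<forall>\<^sub>F n in sequentially. \<forall>p\<in>cball c R. \<forall>q\<in>cball c R.
          \<bar>mean n (loss c p) x - mean n (loss c q) x\<bar> \<le> L * dist p q" for R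
      proof
        show "\<forall>\<^sub>F n in sequentially. \<forall>p\<in>cball c R. \<forall>q\<in>cball c R.
          \<bar>mean n (loss c p) x - mean n (loss c q) x\<bar> \<le> b * (m + 1 + h R) * dist p q"
          using moment' eventually_gt_at_top[of 0]
          by eventually_elim (blast intro: mean_loss_lipschitz)
      qed
      show "(\<lambda>n. one_sided_hausdorff (B n) (argmin F)) \<longlonglongrightarrow> 0"
      proof (rule eps_argmin_hausdorff_tendsto_zero[where Fn = "\<lambda>n q. mean n (loss c q) x"])
        show "(\<lambda>n. mean n (loss c q) x) \<longlonglongrightarrow> F q" for q
          by (rule tendsto_from_dense[where Fn = "\<lambda>n q. mean n (loss c q) x", OF dense _ lip F_lip])
            (use elim(1) in auto)
        show "\<exists>L. \<forall>\<^sub>F n in sequentially. \<forall>p\<in>cball c R. \<forall>q\<in>cball c R.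
          \<bar>mean n (loss c p) x - mean n (loss c q) x\<bar> \<le> L * dist p q" for R by (rule lip)
        show "\<forall>\<^sub>F n in sequentially. B n \<subseteq> eps_argmin (e n) (\<lambda>q. mean n (loss c q) x)"
          using eventually_ge_at_top[of 1] by eventually_elim (use B in auto)
        have "\<forall>\<^sub>F n in sequentially. e n < 1" using e by (rule order_tendstoD) simp
        with R eventually_ge_at_top[of 1] show "\<forall>\<^sub>F n in sequentially. B n \<subseteq> cball c R"
        proof eventually_elim
          case (elim n)
          show ?case
          proof
            fix q assume "q \<in> B n"
            then have "mean n (loss c q) x \<le> e n + mean n (loss c c) x"
              using B elim(2) by (auto dest: eps_argminD)
            also have "mean n (loss c c) x = 0" by (simp add: mean_def loss_def)
            finally have "mean n (loss c q) x < 1" using elim(3) by simp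
            with elim(1)[rule_format, of q] show "q \<in> cball c R"
              by (cases "R \<le> dist q c") (auto simp: dist_commute)
          qed
        qed
        show "e \<longlonglongrightarrow> 0" by fact
        show "compact A" if "A \<subseteq> (\<Union>n\<in>{N..}. B n)" "closed A" "bounded A" for A
          using compactness that by blast
      qed
    qed
  qed
qed

end

theorem corollary4p4:
  fixes P :: "'w measure"
    and q\<^sub>0 :: "'q :: polish_space"
    and Y :: "'w \<Rightarrow> 'q"
    and Ys :: "nat \<Rightarrow> 'w \<Rightarrow> 'q"
    and h H :: "real \<Rightarrow> real"
    and \<epsilon> :: "nat \<Rightarrow> real"
    and M :: "'q set"
    and Mn :: "nat \<Rightarrow> 'w \<Rightarrow> 'q set"
  assumes prob: "prob_space P"
    and Y_rv: "Y \<in> borel_measurable P"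
    and Ys_indep: "prob_space.indep_vars P (\<lambda>_. borel) Ys {1..}"
    and Ys_distr: "\<And>i. i \<ge> 1 \<Longrightarrow> distr P borel (Ys i) = distr P borel Y"
    and h_nonneg: "\<And>x. 0 \<le> x \<Longrightarrow> 0 \<le> h x"
    and h_mono: "mono_on {0..} h"
    and H_eq: "\<And>x. 0 \<le> x \<Longrightarrow> H x = integral {0..x} h"
    and eps_nonneg: "\<And>n. n \<ge> 1 \<Longrightarrow> 0 \<le> \<epsilon> n"
    and eps_lim: "\<epsilon> \<longlonglongrightarrow> 0"
    and M_eq: "M = argmin (\<lambda>q. \<integral>\<omega>. (H (dist (Y \<omega>) q) - H (dist (Y \<omega>) q\<^sub>0)) \<partial>P)"
    and Mn_eq: "\<And>n \<omega>. n \<ge> 1 \<Longrightarrow> Mn n \<omega> = eps_argmin (\<epsilon> n)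
          (\<lambda>q. 1 / real n * (\<Sum>i=1..n. H (dist (Ys i \<omega>) q) - H (dist (Ys i \<omega>) q\<^sub>0)))"
    and compactness: "AE \<omega> in P. \<exists>N\<^sub>0\<ge>1. \<forall>A. A \<subseteq> (\<Union>n\<in>{N\<^sub>0..}. Mn n \<omega>) \<longrightarrow>
          closed A \<longrightarrow> bounded A \<longrightarrow> compact A"
    and doubling: "\<exists>b\<ge>1. \<forall>x\<ge>0. h (2 * x) \<le> b * h x"
    and h_lim: "filterlim h at_top at_top"
    and h_moment: "integrable P (\<lambda>\<omega>. h (dist (Y \<omega>) q\<^sub>0))"
  shows "AE \<omega> in P. (\<lambda>n. one_sided_hausdorff (Mn n \<omega>) M) \<longlonglongrightarrow> 0"
proof -
  interpret P: prob_space P by fact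
  obtain b where b: "b \<ge> 1" "\<forall>x\<ge>0. h (2 * x) \<le> b * h x" using doubling by blast
  interpret doubling_loss h H b
    by unfold_locales (use h_nonneg h_mono H_eq b in auto)
  define D where "D = distr P borel Y"
  have D: "prob_space D" unfolding D_def by (rule P.prob_space_distr) fact
  have moment: "integrable D (\<lambda>y. h (dist y q\<^sub>0))"
    unfolding D_def
    by (subst integrable_distr_eq) (use Y_rv h_dist_measurable h_moment in auto)
  have M: "M = argmin (\<lambda>q. \<integral>y. loss q\<^sub>0 q y \<partial>D)"
    unfolding M_eq D_def
    by (subst integral_distr[OF Y_rv loss_measurable]) (simp add: loss_def)
  have objective: "1 / real n * (\<Sum>i=1..n. H (dist (Ys i \<omega>) q) - H (dist (Ys i \<omega>) q\<^sub>0))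
      = mean n (loss q\<^sub>0 q) (\<lambda>i. Ys (Suc i) \<omega>)" for n q \<omega>
    by (simp add: mean_def loss_def sum.atLeast1_atMost_eq)
  have "AE \<omega> in P. \<forall>B N.
     (\<forall>n\<ge>1. B n = eps_argmin (\<epsilon> n) (\<lambda>q. mean n (loss q\<^sub>0 q) (\<lambda>i. Ys (Suc i) \<omega>))) \<longrightarrow>
     (\<forall>A. A \<subseteq> (\<Union>n\<in>{N..}. B n) \<longrightarrow> closed A \<longrightarrow> bounded A \<longrightarrow> compact A) \<longrightarrow>
     (\<lambda>n. one_sided_hausdorff (B n) M) \<longlonglongrightarrow> 0"
    unfolding M
    by (rule P.AE_iid_sequence[OF Ys_indep _ AE_eps_argmin_consistent[OF D _ moment h_lim eps_lim]])
      (auto simp: Ys_distr D_def)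
  with compactness show ?thesis
  proof eventually_elim
    case (elim \<omega>)
    then obtain N where "\<forall>A. A \<subseteq> (\<Union>n\<in>{N..}. Mn n \<omega>) \<longrightarrow> closed A \<longrightarrow> bounded A \<longrightarrow> compact A"
      by blast
    then show ?case
      using elim(2)[rule_format, of "\<lambda>n. Mn n \<omega>" N] Mn_eq[unfolded objective] by blast
  qed
qed

end
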